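(* Let $(\mathbb{X},|\cdot|)$ be a Banach space and let $f:\mathbb{R}\to\mathbb{X}$ be Bohr-almost periodic. Then for any fixed $\alpha\in\mathbb{R}$ with $|\alpha|>1$, \[ \lim_{N\to\infty}\frac{1}{N}\sum_{n=0}^{N-1} f(\alpha^n x)=M(f) \] (limit in the norm of $\mathbb{X}$) for Lebesgue-almost every $x\in\mathbb{R}$.
   Context: A continuous function $f:\mathbb{R}\to\mathbb{X}$ into a Banach space is Bohr-almost periodic if for every $\varepsilon>0$ the set $\{t\in\mathbb{R}: \sup_{x\in\mathbb{R}}|f(x)-f(x-t)|<\varepsilon\}$ is relatively dense in $\mathbb{R}$ (equivalently, $f$ is a uniform limit on $\mathbb{R}$ of $\mathbb{X}$-valued trigonometric polynomials $a_0+\sum_{\ell=1}^m e^{2\pi i k_\ell x}a_\ell$ with $a_\ell\in\mathbb{X}$, $k_\ell\in\mathbb{R}$). Its mean is $M(f)=\lim_{T\to\infty}\frac{1}{2T}\int_{-T}^{T}f(y)\,\mathrm{d}y\in\mathbb{X}$, where the integral is the Bochner integral. *)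

theory Defs
  imports "HOL-Analysis.Analysis"
begin

text \<open>
  The library's Bochner integral is restricted to second-countable (i.e. separable) spaces.
  The following is the same construction without that restriction, so that it applies to
  functions with values in an arbitrary Banach space.
\<close>

inductive has_Bochner_integral ::
  "'a measure \<Rightarrow> ('a \<Rightarrow> 'b::real_normed_vector) \<Rightarrow> 'b \<Rightarrow> bool"
  for M f x where
  "f \<in> borel_measurable M \<Longrightarrow>
    (\<And>i. Bochner_Integration.simple_bochner_integrable M (s i)) \<Longrightarrow>
    (\<lambda>i. \<integral>\<^sup>+y. norm (f y - s i y) \<partial>M) \<longlonglongrightarrow> 0 \<Longrightarrow>
    (\<lambda>i. Bochner_Integration.simple_bochner_integral M (s i)) \<longlonglongrightarrow> x \<Longrightarrow>
    has_Bochner_integral M f x"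

definition Bochner_integral :: "'a measure \<Rightarrow> ('a \<Rightarrow> 'b::real_normed_vector) \<Rightarrow> 'b" where
  "Bochner_integral M f =
    (if \<exists>x. has_Bochner_integral M f x then THE x. has_Bochner_integral M f x else 0)"

lemma Bochner_integral_eq_lebesgue_integral:
  fixes f :: "'a \<Rightarrow> 'b::{real_normed_vector, second_countable_topology}"
  shows "Bochner_integral M f = lebesgue_integral M f"
  unfolding Bochner_integral_def lebesgue_integral_def
    has_Bochner_integral.simps has_bochner_integral.simps ..

definition relatively_dense :: "real set \<Rightarrow> bool" where
  "relatively_dense S \<longleftrightarrow> (\<exists>L>0. \<forall>a. S \<inter> {a..a + L} \<noteq> {})"

text \<open>
  The supremum is taken in the extended reals because it may be infinite
  for a function that is not yet known to be bounded.
\<close>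

definition Bohr_almost_periodic :: "(real \<Rightarrow> 'a::real_normed_vector) \<Rightarrow> bool" where
  "Bohr_almost_periodic f \<longleftrightarrow>
    continuous_on UNIV f \<and>
    (\<forall>\<epsilon>>0. relatively_dense {t. (SUP x. ereal (norm (f x - f (x - t)))) < ereal \<epsilon>})"

definition mean :: "(real \<Rightarrow> 'a::banach) \<Rightarrow> 'a" where
  "mean f = Lim at_top
    (\<lambda>T::real. (1 / (2 * T)) *\<^sub>R Bochner_integral lborel (\<lambda>y. indicator {-T..T} y *\<^sub>R f y))"

end

theory Submission
  imports Defs
begin

text \<open>
  No Fourier analysis is needed. For a real almost periodic \<open>g\<close> whose integral over every interval
  of some fixed length \<open>L\<close> is nonpositive, put \<open>h = exp (l * g)\<close> with small \<open>l > 0\<close> and take \<open>\<beta>\<close>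
  a large even power of \<open>\<alpha>\<close>. On short intervals \<open>h\<close> is nearly constant, while functions of \<open>\<beta> * y\<close>
  already average out there, so the integrals of the products of \<open>h (\<beta> ^ j * y)\<close> over \<open>j < J\<close> grow at most like
  \<open>exp (o(l) * J)\<close>: the functions \<open>g (\<beta> ^ j * y)\<close> behave like independent variables. This exponential
  moment bound, summed over \<open>J\<close>, makes the averages asymptotically nonpositive almost everywhere.

  A Banach-valued almost periodic \<open>f\<close> has relatively compact range, so a finite partition of unity
  on that range approximates \<open>f\<close> uniformly by a finite sum of real almost periodic functions times
  fixed vectors. Existence of the mean is a by-product: the means over \<open>{-T..T}\<close> are all close to the
  averages along the orbit of one generic point, hence close to each other.
\<close>

section \<open>Exponential moments of lacunary sums\<close>

lemma continuous_UNIV_integrable_on [intro]: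
  fixes f :: "real \<Rightarrow> 'a::banach"
  assumes "continuous_on UNIV f"
  shows "f integrable_on {a..b}"
  using assms by (intro integrable_continuous_real continuous_on_subset[OF assms]) auto

lemma integral_blocks_le:
  fixes F G :: "real \<Rightarrow> real"
  assumes F: "continuous_on UNIV F" and G: "continuous_on UNIV G" and "d \<ge> 0"
    and le: "\<And>u. integral {u..u + d} F \<le> integral {u..u + d} G"
  shows "integral {u..u + real m * d} F \<le> integral {u..u + real m * d} G"
proof (induction m)
  case (Suc m)
  have split: "integral {u..u + real (Suc m) * d} K
      = integral {u..u + real m * d} K + integral {u + real m * d..u + real m * d + d} K"
    if "continuous_on UNIV K" for K :: "real \<Rightarrow> real"
  proof -
    have "integral {u..u + real m * d} K + integral {u + real m * d..u + real (Suc m) * d} K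
        = integral {u..u + real (Suc m) * d} K"
      using \<open>d \<ge> 0\<close> by (intro Henstock_Kurzweil_Integration.integral_combine
          continuous_UNIV_integrable_on that) (auto simp: mult_right_mono)
    then show ?thesis by (simp add: algebra_simps)
  qed
  show ?case
    unfolding split[OF F] split[OF G] by (intro add_mono Suc le)
qed auto

lemma integral_dilation:
  fixes R :: "real \<Rightarrow> real"
  assumes R: "continuous_on UNIV R" and "\<beta> > 0"
  shows "integral {u..v} (\<lambda>y. R (\<beta> * y)) = integral {\<beta> * u..\<beta> * v} R / \<beta>"
proof -
  have "(R has_integral integral {\<beta> * u..\<beta> * v} R) (cbox (\<beta> * u) (\<beta> * v))"
    using continuous_UNIV_integrable_on[OF R] by (simp add: has_integral_integral)
  from has_integral_affinity'[OF this \<open>\<beta> > 0\<close>, of 0] show ?thesis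
    using \<open>\<beta> > 0\<close> by (intro integral_unique) (simp add: field_simps)
qed

text \<open>
  On each of the \<open>m\<close> pieces of length \<open>L / m\<close> the factor \<open>h\<close> may be taken out of the integral, because
  the dilated piece contains so many blocks of length \<open>L\<close> that only the block average of \<open>R\<close> matters.
\<close>

lemma integral_mult_dilated_le:
  fixes h R :: "real \<Rightarrow> real"
  assumes h: "continuous_on UNIV h" and R: "continuous_on UNIV R"
    and h0: "\<And>x. h x \<ge> 0" and R0: "\<And>x. R x \<ge> 0"
    and "m > 0" "L > 0" "\<beta> > 0" "A \<ge> 0" "\<eta> \<ge> 0" "e \<ge> 0"
    and near: "\<And>x y. \<bar>x - y\<bar> \<le> L / real m \<Longrightarrow> h x \<le> e * h y"
    and RA: "\<And>c. integral {c..c + L} R \<le> L * A"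
    and hH: "\<And>c. integral {c..c + L} h \<le> L * H"
    and big: "real m \<le> \<beta> * \<eta>"
  shows "integral {c..c + L} (\<lambda>y. h y * R (\<beta> * y)) \<le> L * (e * (1 + \<eta>) * H * A)"
proof -
  define d where "d = L / real m"
  have d: "d > 0" "real m * d = L" using \<open>m > 0\<close> \<open>L > 0\<close> by (auto simp: d_def)
  have Rb: "continuous_on UNIV (\<lambda>y. R (\<beta> * y))"
    by (intro continuous_on_compose2[OF R] continuous_intros) auto
  have cont: "continuous_on UNIV (\<lambda>y. h y * R (\<beta> * y))"
    by (intro continuous_intros h Rb)
  \<comment> \<open>The dilated piece is rounded up to \<open>k\<close> whole blocks of length
    \<open>L\<close>, which is harmless because \<open>R\<close> is nonnegative. The overshoot is at
    most \<open>L\<close>, and \<open>big\<close> multiplied by \<open>d\<close> makes this at most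
    the fraction \<open>\<eta>\<close> of the length \<open>\<beta> * d\<close>.\<close>
  have long: "integral {v..v + \<beta> * d} R \<le> \<beta> * d * (1 + \<eta>) * A" for v
  proof -
    define k where "k = nat \<lceil>\<beta> * d / L\<rceil>"
    have "\<beta> * d / L \<ge> 0" using \<open>L > 0\<close> \<open>\<beta> > 0\<close> d by simp
    then have k: "\<beta> * d / L \<le> real k" "real k \<le> \<beta> * d / L + 1"
      unfolding k_def using ceiling_correct[of "\<beta> * d / L"] by (auto simp: zero_le_ceiling of_nat_nat)
    have kL: "\<beta> * d \<le> real k * L" "real k * L \<le> \<beta> * d + L"
      using k \<open>L > 0\<close> by (simp_all add: field_simps)
    have "integral {v..v + \<beta> * d} R \<le> integral {v..v + real k * L} R"
      using kL R0 by (intro integral_subset_le continuous_UNIV_integrable_on R) auto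
    also have "\<dots> \<le> integral {v..v + real k * L} (\<lambda>_. A)"
      using RA \<open>L > 0\<close> by (intro integral_blocks_le R continuous_intros) auto
    also have "\<dots> = real k * L * A" using \<open>L > 0\<close> by simp
    also have "\<dots> \<le> (\<beta> * d + L) * A"
      using kL \<open>A \<ge> 0\<close> by (intro mult_right_mono) auto
    also have "L \<le> \<beta> * d * \<eta>"
      using mult_right_mono[OF big, of d] d by (metis less_imp_le mult.assoc mult.commute)
    then have "(\<beta> * d + L) * A \<le> \<beta> * d * (1 + \<eta>) * A"
      using \<open>A \<ge> 0\<close> by (intro mult_right_mono) (auto simp: algebra_simps)
    finally show ?thesis .
  qed
  define C where "C = e * (1 + \<eta>) * A"
  have C0: "C \<ge> 0" using assms by (auto simp: C_def)
  have piece: "integral {u..u + d} (\<lambda>y. h y * R (\<beta> * y)) \<le> integral {u..u + d} (\<lambda>z. C * h z)" for u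
  proof -
    let ?I = "integral {u..u + d} (\<lambda>y. h y * R (\<beta> * y))"
    \<comment> \<open>The bound holds with \<open>h\<close> frozen at any point \<open>z\<close> of
      the piece. Integrating it over \<open>z\<close> cancels the factor \<open>d\<close> and turns
      \<open>h z\<close> into the integral of \<open>h\<close>, so no extremum of \<open>h\<close>
      has to be chosen.\<close>
    have "?I \<le> d * (C * h z)" if z: "z \<in> {u..u + d}" for z
    proof -
      have "?I \<le> integral {u..u + d} (\<lambda>y. e * h z * R (\<beta> * y))"
        using z R0 by (intro integral_le continuous_UNIV_integrable_on cont continuous_intros Rb
            mult_right_mono near) (auto simp: d_def)
      also have "\<dots> = e * h z * (integral {\<beta> * u..\<beta> * u + \<beta> * d} R / \<beta>)"
        using integral_dilation[OF R \<open>\<beta> > 0\<close>, of u "u + d"] by (simp add: algebra_simps)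
      also have "\<dots> \<le> e * h z * (\<beta> * d * (1 + \<eta>) * A / \<beta>)"
        using \<open>\<beta> > 0\<close> \<open>e \<ge> 0\<close> h0 by (intro mult_left_mono divide_right_mono long) auto
      also have "\<dots> = d * (C * h z)" using \<open>\<beta> > 0\<close> by (simp add: C_def)
      finally show ?thesis .
    qed
    then have "integral {u..u + d} (\<lambda>_. ?I) \<le> integral {u..u + d} (\<lambda>z. d * (C * h z))"
      by (intro integral_le continuous_UNIV_integrable_on continuous_intros h) auto
    then show ?thesis using d by simp
  qed
  have "integral {c..c + L} (\<lambda>y. h y * R (\<beta> * y)) \<le> integral {c..c + L} (\<lambda>z. C * h z)"
    using integral_blocks_le[OF cont _ _ piece, of c m] d by (simp add: continuous_intros h)
  also have "\<dots> \<le> C * (L * H)"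
    using C0 hH by (simp add: mult_left_mono)
  finally show ?thesis by (simp add: C_def algebra_simps)
qed

text \<open>Induction on the number of factors: the factor with \<open>j = 0\<close> is
  \<open>h\<close> itself, and the remaining ones form the shorter product evaluated at
  \<open>\<beta> * y\<close>, which is the \<open>R\<close> of the previous lemma. That lemma needs
  the bound for \<open>R\<close> on every block, hence the arbitrary \<open>c\<close>.\<close>

lemma integral_lacunary_product_le:
  fixes h :: "real \<Rightarrow> real"
  assumes h: "continuous_on UNIV h" and h0: "\<And>x. h x \<ge> 0"
    and "m > 0" "L > 0" "\<beta> > 0" "\<eta> \<ge> 0" "e \<ge> 0" "H \<ge> 0"
    and near: "\<And>x y. \<bar>x - y\<bar> \<le> L / real m \<Longrightarrow> h x \<le> e * h y"
    and hH: "\<And>c. integral {c..c + L} h \<le> L * H"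
    and big: "real m \<le> \<beta> * \<eta>"
  shows "integral {c..c + L} (\<lambda>y. \<Prod>j<J. h (\<beta> ^ j * y)) \<le> L * (e * (1 + \<eta>) * H) ^ J"
proof (induction J arbitrary: c)
  case 0
  then show ?case using \<open>L > 0\<close> by simp
next
  case (Suc J)
  have "(\<lambda>y. \<Prod>j<Suc J. h (\<beta> ^ j * y)) = (\<lambda>y. h y * (\<Prod>j<J. h (\<beta> ^ j * (\<beta> * y))))"
    by (subst prod.lessThan_Suc_shift) (simp add: mult_ac)
  moreover have "integral {c..c + L} (\<lambda>y. h y * (\<Prod>j<J. h (\<beta> ^ j * (\<beta> * y))))
      \<le> L * (e * (1 + \<eta>) * H * (e * (1 + \<eta>) * H) ^ J)"
    using assms Suc
    by (intro integral_mult_dilated_le[where R = "\<lambda>y. \<Prod>j<J. h (\<beta> ^ j * y)" and m = m])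
       (auto intro!: continuous_intros continuous_on_compose2[OF h] prod_nonneg)
  ultimately show ?case by simp
qed

lemma exp_le_one_add_square:
  fixes x :: real
  assumes "\<bar>x\<bar> \<le> 1"
  shows "exp x \<le> 1 + x + x\<^sup>2"
proof (cases "x \<ge> 0")
  case True
  then show ?thesis using exp_bound[of x] assms by auto
next
  case False
  have "exp x = 1 / exp (- x)" by (simp add: exp_minus field_simps)
  also have "\<dots> \<le> 1 / (1 - x)"
    using False exp_ge_add_one_self[of "-x"] by (intro divide_left_mono) (auto simp: mult_pos_pos)
  also have "\<dots> \<le> 1 + x + x\<^sup>2"
  proof -
    have "x ^ 3 \<le> 0" using False by (simp add: power_le_zero_eq)
    then have "1 \<le> (1 + x + x\<^sup>2) * (1 - x)" by (simp add: algebra_simps power2_eq_square power3_eq_cube)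
    then show ?thesis using False by (simp add: divide_le_eq)
  qed
  finally show ?thesis .
qed

lemma AE_on_blocks_imp_AE_lborel:
  assumes "L > 0" and "\<And>c. AE x in lborel. x \<in> {c..c + L} \<longrightarrow> P x"
  shows "AE x::real in lborel. P x"
proof -
  have "AE x in lborel. \<forall>k::int. x \<in> {of_int k * L..of_int k * L + L} \<longrightarrow> P x"
    using assms(2) by (subst AE_all_countable) auto
  then show ?thesis
  proof eventually_elim
    case (elim x)
    have "of_int \<lfloor>x / L\<rfloor> * L \<le> x"
      using of_int_floor_le[of "x / L"] \<open>L > 0\<close> by (subst (asm) pos_le_divide_eq)
    moreover have "x \<le> (of_int \<lfloor>x / L\<rfloor> + 1) * L"
      using real_of_int_floor_add_one_ge[of "x / L"] \<open>L > 0\<close> by (subst (asm) pos_divide_le_eq)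
    ultimately have "x \<in> {of_int \<lfloor>x / L\<rfloor> * L..of_int \<lfloor>x / L\<rfloor> * L + L}"
      by (auto simp: algebra_simps)
    with elim show ?case by blast
  qed
qed

text \<open>A Chernoff bound combined with a Borel-Cantelli argument. The threshold for \<beta>
  depends only on \<open>g\<close>, \<open>L\<close> and \<epsilon>; the exceptional null set may
  change with \<beta>.\<close>

lemma AE_lacunary_sum_le:
  fixes g :: "real \<Rightarrow> real"
  assumes g: "uniformly_continuous_on UNIV g" and B: "\<And>x. \<bar>g x\<bar> \<le> B"
    and "L > 0" and gL: "\<And>c. integral {c..c + L} g \<le> 0" and "\<epsilon> > 0"
  shows "\<exists>\<beta>0. \<forall>\<beta>\<ge>\<beta>0. AE x in lborel. \<forall>\<^sub>F J in sequentially. (\<Sum>j<J. g (\<beta> ^ j * x)) \<le> \<epsilon> * real J"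
proof -
  define D where "D = max B 1"
  have D: "D \<ge> 1" "\<bar>g x\<bar> \<le> D" for x using B[of x] by (auto simp: D_def)
  \<comment> \<open>The first bound on \<open>l\<close> puts \<open>l * g x\<close> into the range
    of the quadratic estimate for exp. The second makes the quadratic error
    \<open>(l * D)\<^sup>2\<close> at most a quarter of the allowance \<open>l * \<epsilon>\<close>
    per factor.\<close>
  define l where "l = min (1 / D) (\<epsilon> / (4 * D\<^sup>2))"
  have l: "l > 0" "l * D \<le> 1" "l * D\<^sup>2 \<le> \<epsilon> / 4"
  proof -
    show "l > 0" using D \<open>\<epsilon> > 0\<close> by (auto simp: l_def)
    have "l \<le> 1 / D" "l \<le> \<epsilon> / (4 * D\<^sup>2)" by (auto simp: l_def)
    then show "l * D \<le> 1" "l * D\<^sup>2 \<le> \<epsilon> / 4" using D(1) by (auto simp: field_simps)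
  qed
  define h where "h x = exp (l * g x)" for x
  have gc: "continuous_on UNIV g" using g by (rule uniformly_continuous_imp_continuous)
  have h: "continuous_on UNIV h" unfolding h_def by (intro continuous_intros gc)
  have h0: "h x \<ge> 0" for x by (simp add: h_def)
  have hH: "integral {c..c + L} h \<le> L * exp (l * (\<epsilon> / 4))" for c
  proof -
    have "h x \<le> l * g x + (1 + (l * D)\<^sup>2)" for x
    proof -
      have le: "\<bar>l * g x\<bar> \<le> l * D"
        using D(2)[of x] l(1) by (simp add: abs_mult)
      then have "h x \<le> 1 + l * g x + (l * g x)\<^sup>2"
        using l(2) unfolding h_def by (intro exp_le_one_add_square) auto
      moreover have "(l * g x)\<^sup>2 \<le> (l * D)\<^sup>2" using le by (rule abs_le_square_iff[THEN iffD1, OF order_trans]) auto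
      ultimately show ?thesis by auto
    qed
    then have "integral {c..c + L} h \<le> integral {c..c + L} (\<lambda>x. l * g x + (1 + (l * D)\<^sup>2))"
      by (intro integral_le continuous_UNIV_integrable_on h continuous_intros gc) auto
    also have "\<dots> = l * integral {c..c + L} g + L * (1 + (l * D)\<^sup>2)"
      using \<open>L > 0\<close>
      by (subst integral_add) (auto intro!: continuous_UNIV_integrable_on continuous_intros gc)
    also have "\<dots> \<le> L * (1 + (l * D)\<^sup>2)"
      using gL[of c] l(1) by (simp add: mult_nonneg_nonpos)
    also have "(l * D)\<^sup>2 \<le> l * (\<epsilon> / 4)"
      using mult_left_mono[OF l(3), of l] l(1) by (simp add: power2_eq_square algebra_simps)
    then have "L * (1 + (l * D)\<^sup>2) \<le> L * exp (l * (\<epsilon> / 4))"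
      using exp_ge_add_one_self[of "l * (\<epsilon> / 4)"] \<open>L > 0\<close> by (intro mult_left_mono) linarith+
    finally show ?thesis .
  qed
  obtain \<delta> where \<delta>: "\<delta> > 0" "\<And>x y. \<bar>x - y\<bar> < \<delta> \<Longrightarrow> \<bar>g x - g y\<bar> < \<epsilon> / 4"
    using g \<open>\<epsilon> > 0\<close> unfolding uniformly_continuous_on_def dist_real_def
    by (metis UNIV_I divide_pos_pos zero_less_numeral)
  obtain m :: nat where m: "real m > L / \<delta>" using reals_Archimedean2 by blast
  have m0: "m > 0" using m \<open>L > 0\<close> \<delta>(1) by (cases m) (auto simp: field_simps)
  have near: "h x \<le> exp (l * (\<epsilon> / 4)) * h y" if "\<bar>x - y\<bar> \<le> L / real m" for x y
  proof -
    have "L / real m < \<delta>" using m m0 \<delta>(1) by (simp add: field_simps)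
    then have "g x \<le> \<epsilon> / 4 + g y" using \<delta>(2)[of x y] that by linarith
    then have "l * g x \<le> l * (\<epsilon> / 4) + l * g y"
      using mult_left_mono[of "g x" "\<epsilon> / 4 + g y" l] l(1) by (simp add: algebra_simps)
    then show ?thesis by (simp add: h_def flip: exp_add)
  qed
  define \<eta> where "\<eta> = l * (\<epsilon> / 4)"
  have \<eta>: "\<eta> > 0" using l \<open>\<epsilon> > 0\<close> by (simp add: \<eta>_def)
  show ?thesis
  proof (intro exI[of _ "real m / \<eta>"] allI impI)
    fix \<beta> assume \<beta>: "\<beta> \<ge> real m / \<eta>"
    have "real m / \<eta> > 0" using m0 \<eta> by simp
    then have \<beta>0: "\<beta> > 0" using \<beta> by linarith
    \<comment> \<open>With \<open>\<eta> = l * \<epsilon> / 4\<close>, each factor of the product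
      costs at most exp (3 \<eta>): one \<eta> for the oscillation of \<open>h\<close>, one for
      rounding to whole blocks, one for the mean of \<open>h\<close>. The normalisation by exp (-4
      \<eta> J), which is exp (-l \<epsilon> J), therefore leaves geometric decay.\<close>
    define Q where "Q J y = exp (- (4 * \<eta> * real J)) * (\<Prod>j<J. h (\<beta> ^ j * y))" for J y
    have Qc: "continuous_on UNIV (Q J)" for J
      unfolding Q_def by (intro continuous_intros continuous_on_compose2[OF h]) auto
    have Q0: "Q J y \<ge> 0" for J y
      unfolding Q_def using h0 by (simp add: prod_nonneg)
    define q where "q = exp (- \<eta>)"
    have q: "0 \<le> q" "q < 1" using \<eta> by (auto simp: q_def)
    have QI: "integral {c..c + L} (Q J) \<le> L * q ^ J" for c J
    proof -
      have "integral {c..c + L} (\<lambda>y. \<Prod>j<J. h (\<beta> ^ j * y)) \<le> L * (exp \<eta> * (1 + \<eta>) * exp \<eta>) ^ J"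
        using m0 \<open>L > 0\<close> \<beta>0 \<eta> near hH \<beta> unfolding \<eta>_def[symmetric]
        by (intro integral_lacunary_product_le[OF h h0, where m = m]) (auto simp: field_simps)
      also have "\<dots> \<le> L * (exp \<eta> * exp \<eta> * exp \<eta>) ^ J"
        using exp_ge_add_one_self[of \<eta>] \<eta> \<open>L > 0\<close>
        by (intro mult_left_mono power_mono mult_right_mono) auto
      also have "(exp \<eta> * exp \<eta> * exp \<eta>) ^ J = exp (3 * \<eta> * real J)"
        by (simp add: mult.commute flip: exp_add exp_of_nat_mult)
      finally have "exp (- (4 * \<eta> * real J)) * integral {c..c + L} (\<lambda>y. \<Prod>j<J. h (\<beta> ^ j * y))
          \<le> exp (- (4 * \<eta> * real J)) * (L * exp (3 * \<eta> * real J))"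
        by (intro mult_left_mono) auto
      also have "\<dots> = L * q ^ J"
        unfolding q_def by (simp add: algebra_simps flip: exp_add exp_of_nat_mult)
      finally show ?thesis unfolding Q_def by simp
    qed
    \<comment> \<open>The integrals of \<open>Q J\<close> over a block are summable in
      \<open>J\<close>, so by monotone convergence the series of the \<open>Q J x\<close> is finite
      for almost every \<open>x\<close> in the block, and its terms tend to 0.\<close>
    have block: "AE x in lborel. x \<in> {c..c + L} \<longrightarrow> (\<forall>\<^sub>F J in sequentially. Q J x < 1)" for c
    proof -
      have meas: "(\<lambda>x. ennreal (Q J x) * indicator {c..c + L} x) \<in> borel_measurable lborel" for J
        using borel_measurable_continuous_onI[OF Qc[of J]] by measurable
      have "(\<integral>\<^sup>+x. (\<Sum>J. ennreal (Q J x) * indicator {c..c + L} x) \<partial>lborel)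
          = (\<Sum>J. \<integral>\<^sup>+x. ennreal (Q J x) * indicator {c..c + L} x \<partial>lborel)"
        by (intro nn_integral_suminf meas)
      also have "\<dots> = (\<Sum>J. ennreal (integral {c..c + L} (Q J)))"
        using continuous_UNIV_integrable_on[OF Qc] Q0
        by (intro arg_cong[where f = suminf] ext nn_integral_has_integral_lebesgue')
           (auto simp: has_integral_integral)
      also have "\<dots> \<le> (\<Sum>J. ennreal (L * q ^ J))"
        by (intro suminf_le ennreal_leI QI) auto
      also have "\<dots> = ennreal (\<Sum>J. L * q ^ J)"
        using q \<open>L > 0\<close> by (intro suminf_ennreal2 summable_mult summable_geometric) auto
      also have "\<dots> < \<infinity>" by simp
      finally have "AE x in lborel. (\<Sum>J. ennreal (Q J x) * indicator {c..c + L} x) \<noteq> \<infinity>"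
        by (intro nn_integral_PInf_AE borel_measurable_suminf_order meas) auto
      then show ?thesis
      proof eventually_elim
        case (elim x)
        show ?case
        proof
          assume "x \<in> {c..c + L}"
          with elim have "(\<Sum>J. ennreal (Q J x)) \<noteq> top" by simp
          then have "summable (\<lambda>J. Q J x)" using Q0 by (intro summable_suminf_not_top) auto
          then have "(\<lambda>J. Q J x) \<longlonglongrightarrow> 0" by (rule summable_LIMSEQ_zero)
          then show "\<forall>\<^sub>F J in sequentially. Q J x < 1" by (rule order_tendstoD) simp
        qed
      qed
    qed
    from AE_on_blocks_imp_AE_lborel[OF \<open>L > 0\<close> this]
    show "AE x in lborel. \<forall>\<^sub>F J in sequentially. (\<Sum>j<J. g (\<beta> ^ j * x)) \<le> \<epsilon> * real J"
    proof eventually_elim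
      case (elim x)
      then show ?case
      proof eventually_elim
        case (elim J)
        \<comment> \<open>Since \<open>4 * \<eta> = l * \<epsilon>\<close>, the condition
          \<open>Q J x < 1\<close> is the desired inequality after taking logarithms.\<close>
        have "Q J x = exp (l * ((\<Sum>j<J. g (\<beta> ^ j * x)) - \<epsilon> * real J))"
          unfolding Q_def h_def \<eta>_def
          by (simp add: sum_distrib_left algebra_simps flip: exp_add exp_sum)
        with elim have "l * ((\<Sum>j<J. g (\<beta> ^ j * x)) - \<epsilon> * real J) < 0" by simp
        then show ?case using l(1) by (simp add: mult_less_0_iff)
      qed
    qed
  qed
qed

section \<open>Real functions: from powers of a large \<beta> to powers of \<alpha>, and to
  means\<close>

lemma AE_lebesgue_scale:
  assumes "AE x::real in lebesgue. P x" and "c \<noteq> 0"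
  shows "AE x in lebesgue. P (c * x)"
proof -
  obtain N where N: "negligible N" "{x. \<not> P x} \<subseteq> N"
    using assms(1) unfolding eventually_ae_filter_negligible by blast
  have "negligible ((\<lambda>x. x / c) ` N)"
    using N(1) by (rule negligible_differentiable_image_negligible[OF order_refl])
      (auto intro!: linear_imp_differentiable_on bounded_linear.linear[OF bounded_linear_divide])
  moreover have "{x. \<not> P (c * x)} \<subseteq> (\<lambda>x. x / c) ` N"
    using N(2) \<open>c \<noteq> 0\<close> by (force intro!: image_eqI[where x = "c * _"])
  ultimately show ?thesis
    unfolding eventually_ae_filter_negligible by blast
qed

text \<open>A power \<open>\<beta> = \<alpha> ^ p\<close> is large enough for the previous result.
  Sorting the exponents by their residue \<open>r\<close> modulo \<open>p\<close> splits the orbit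
  of \<open>x\<close> into \<open>p\<close> orbits under \<beta>, started at the points
  \<open>\<alpha> ^ r * x\<close>; dilations preserve null sets, so almost every \<open>x\<close> is
  good for all residues.\<close>

lemma AE_lacunary_average_le:
  fixes g :: "real \<Rightarrow> real"
  assumes g: "uniformly_continuous_on UNIV g" and B: "\<And>x. \<bar>g x\<bar> \<le> B"
    and "L > 0" and gL: "\<And>c. integral {c..c + L} g \<le> 0" and "\<epsilon> > 0" and \<alpha>: "\<bar>\<alpha>\<bar> > 1"
  shows "AE x in lebesgue. \<forall>\<^sub>F N in sequentially. (\<Sum>n<N. g (\<alpha> ^ n * x)) \<le> \<epsilon> * real N"
proof -
  obtain \<beta>0 where \<beta>0: "\<And>\<beta>. \<beta> \<ge> \<beta>0 \<Longrightarrow>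
      AE x in lborel. \<forall>\<^sub>F J in sequentially. (\<Sum>j<J. g (\<beta> ^ j * x)) \<le> \<epsilon> / 2 * real J"
    using AE_lacunary_sum_le[OF g B \<open>L > 0\<close> gL, of "\<epsilon> / 2"] \<open>\<epsilon> > 0\<close> by auto
  obtain k where k: "\<bar>\<alpha>\<bar> ^ k > max \<beta>0 1" using real_arch_pow[OF \<alpha>] by blast
  then have "k \<noteq> 0" by (intro notI) auto
  \<comment> \<open>an even exponent makes \<open>\<beta>\<close> positive for negative \<open>\<alpha>\<close>\<close>
  define p where "p = 2 * k"
  define \<beta> where "\<beta> = \<alpha> ^ p"
  have "p > 0" using \<open>k \<noteq> 0\<close> by (simp add: p_def)
  have "\<beta> = (\<bar>\<alpha>\<bar> ^ k)\<^sup>2" by (simp add: \<beta>_def p_def power_mult power_even_abs mult.commute[of 2] flip: power_abs)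
  moreover have "(\<bar>\<alpha>\<bar> ^ k)\<^sup>2 \<ge> \<bar>\<alpha>\<bar> ^ k" using k by (intro self_le_power) auto
  ultimately have "\<beta> \<ge> \<beta>0" using k by auto
  have "AE x in lebesgue. \<forall>\<^sub>F J in sequentially. (\<Sum>j<J. g (\<beta> ^ j * x)) \<le> \<epsilon> / 2 * real J"
    using \<beta>0[OF \<open>\<beta> \<ge> \<beta>0\<close>] by (rule AE_completion)
  then have "AE x in lebesgue. \<forall>\<^sub>F J in sequentially. (\<Sum>j<J. g (\<beta> ^ j * (\<alpha> ^ r * x))) \<le> \<epsilon> / 2 * real J" for r
    using \<alpha> by (intro AE_lebesgue_scale) auto
  then have "AE x in lebesgue. \<forall>r\<in>{..<p}. \<forall>\<^sub>F J in sequentially.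
      (\<Sum>j<J. g (\<beta> ^ j * (\<alpha> ^ r * x))) \<le> \<epsilon> / 2 * real J"
    by (intro AE_finite_allI) auto
  then show ?thesis
  proof eventually_elim
    case (elim x)
    then have "\<forall>\<^sub>F J in sequentially. \<forall>r\<in>{..<p}. (\<Sum>j<J. g (\<beta> ^ j * (\<alpha> ^ r * x))) \<le> \<epsilon> / 2 * real J"
      by (intro eventually_ball_finite) auto
    moreover have "filterlim (\<lambda>N. N div p) sequentially sequentially"
      by (rule filterlim_at_top_div_const_nat[OF \<open>p > 0\<close>])
    ultimately have "\<forall>\<^sub>F N in sequentially. \<forall>r\<in>{..<p}.
        (\<Sum>j<N div p. g (\<beta> ^ j * (\<alpha> ^ r * x))) \<le> \<epsilon> / 2 * real (N div p)"
      by (rule eventually_compose_filterlim)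
    \<comment> \<open>Fewer than \<open>p\<close> terms are left over after the last complete group.
      For such \<open>N\<close> their total, at most \<open>p * B\<close>, fits into the second half
      of \<epsilon>.\<close>
    moreover have "\<forall>\<^sub>F N in sequentially. real N \<ge> real p * B / (\<epsilon> / 2)"
      using filterlim_real_sequentially by (simp add: filterlim_at_top)
    ultimately show ?case
    proof eventually_elim
      case (elim N)
      define J where "J = N div p"
      have JN: "J * p \<le> N" "N < J * p + p"
        using \<open>p > 0\<close> dividend_less_div_times[of p N] by (auto simp: J_def)
      have "B \<ge> 0" using B[of 0] by auto
      define G where "G n = g (\<alpha> ^ n * x)" for n
      have "(\<Sum>n<J * p. G n) = (\<Sum>j<J. \<Sum>n\<in>{j * p..<j * p + p}. G n)"
        by (rule sum.nat_group[symmetric])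
      also have "\<dots> = (\<Sum>j<J. \<Sum>r<p. G (r + j * p))"
        by (simp add: sum.shift_bounds_nat_ivl[of G 0 _ p, simplified] lessThan_atLeast0 add.commute
            sum.atLeastLessThan_shift_0[of _ "_ * p"])
      also have "\<dots> = (\<Sum>r<p. \<Sum>j<J. G (r + j * p))" by (rule sum.swap)
      also have "\<dots> = (\<Sum>r<p. \<Sum>j<J. g (\<beta> ^ j * (\<alpha> ^ r * x)))"
        by (simp add: G_def \<beta>_def power_add mult_ac flip: power_mult)
      also have "\<dots> \<le> (\<Sum>r<p. \<epsilon> / 2 * real J)"
        using elim(1) by (intro sum_mono) (auto simp: J_def)
      also have "\<dots> = \<epsilon> / 2 * real (J * p)" by simp
      also have "\<dots> \<le> \<epsilon> / 2 * real N"
        using JN(1) \<open>\<epsilon> > 0\<close> by (intro mult_left_mono) linarith+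
      finally have 1: "(\<Sum>n<J * p. G n) \<le> \<epsilon> / 2 * real N" .
      have "(\<Sum>n\<in>{J * p..<N}. G n) \<le> (\<Sum>n\<in>{J * p..<N}. B)"
        using B by (intro sum_mono) (auto simp: G_def abs_le_iff)
      also have "\<dots> = real (N - J * p) * B" by simp
      also have "\<dots> \<le> real p * B" using JN \<open>B \<ge> 0\<close> by (intro mult_right_mono of_nat_mono) auto
      also have "\<dots> \<le> \<epsilon> / 2 * real N" using elim(2) \<open>\<epsilon> > 0\<close> by (simp add: field_simps)
      finally have 2: "(\<Sum>n\<in>{J * p..<N}. G n) \<le> \<epsilon> / 2 * real N" .
      have "(\<Sum>n<N. G n) = (\<Sum>n<J * p. G n) + (\<Sum>n\<in>{J * p..<N}. G n)"
        using JN(1) by (simp add: lessThan_atLeast0 sum.atLeastLessThan_concat)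
      with 1 2 show ?case by (simp add: G_def)
    qed
  qed
qed

text \<open>An almost period \<open>t\<close> carries the window at \<open>b\<close> to one starting
  at \<open>a + s\<close> with \<open>0 \<le> s \<le> l\<close>. This costs at most \<epsilon>/2 per
  unit length. The windows at \<open>a\<close> and \<open>a + s\<close> differ by two end pieces of
  length at most \<open>l\<close>, whose contribution \<open>2 * l * B\<close> is negligible against
  a long window.\<close>

lemma integral_block_almost_invariant:
  fixes g :: "real \<Rightarrow> real"
  assumes g: "continuous_on UNIV g" and B: "\<And>x. \<bar>g x\<bar> \<le> B"
    and ap: "\<And>\<epsilon>. \<epsilon> > 0 \<Longrightarrow> \<exists>l>0. \<forall>a. \<exists>t\<in>{a..a + l}. \<forall>x. \<bar>g x - g (x - t)\<bar> < \<epsilon>"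
    and "\<epsilon> > 0"
  shows "\<exists>L0>0. \<forall>L\<ge>L0. \<forall>a b. integral {a..a + L} g \<le> integral {b..b + L} g + \<epsilon> * L"
proof -
  obtain l where l: "l > 0" "\<And>a. \<exists>t\<in>{a..a + l}. \<forall>x. \<bar>g x - g (x - t)\<bar> < \<epsilon> / 2"
    using ap[of "\<epsilon> / 2"] \<open>\<epsilon> > 0\<close> by auto
  have "B \<ge> 0" using B[of 0] by auto
  define L0 where "L0 = max 1 (2 * l * B / (\<epsilon> / 2))"
  have "integral {a..a + L} g \<le> integral {b..b + L} g + \<epsilon> * L" if L: "L \<ge> L0" for L a b
  proof -
    have "L > 0" using L by (auto simp: L0_def)
    obtain t where t: "t \<in> {a - b..a - b + l}" "\<And>x. \<bar>g x - g (x - t)\<bar> < \<epsilon> / 2"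
      using l(2) by blast
    define s where "s = b + t - a"
    have s: "0 \<le> s" "s \<le> l" using t(1) by (auto simp: s_def)
    note int = continuous_UNIV_integrable_on[OF g]
    have "integral {a..a + L} g + integral {a + L..a + s + L} g = integral {a..a + s + L} g"
      "integral {a..a + s} g + integral {a + s..a + s + L} g = integral {a..a + s + L} g"
      using s \<open>L > 0\<close> by (intro Henstock_Kurzweil_Integration.integral_combine int; simp)+
    moreover have small: "\<bar>integral {u..v} g\<bar> \<le> l * B" if "u \<le> v" "v - u \<le> l" for u v
    proof -
      have "norm (integral {u..v} g) \<le> B * (v - u)"
        using g B that by (intro integral_bound continuous_on_subset[OF g]) auto
      also have "\<dots> \<le> B * l" using that \<open>B \<ge> 0\<close> by (intro mult_left_mono) auto
      finally show ?thesis by (simp add: mult.commute)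
    qed
    moreover have "\<bar>integral {a + L..a + s + L} g\<bar> \<le> l * B" "\<bar>integral {a..a + s} g\<bar> \<le> l * B"
      using s by (auto intro!: small)
    moreover have "integral {a + s..a + s + L} g = integral {b..b + L} (\<lambda>y. g (y + t))"
      using has_integral_affinity'[of g "integral {a + s..a + s + L} g" "a + s" "a + s + L" 1 t]
      by (simp add: int integrable_integral s_def algebra_simps integral_unique)
    moreover have "integral {b..b + L} (\<lambda>y. g (y + t)) \<le> integral {b..b + L} (\<lambda>y. g y + \<epsilon> / 2)"
    proof (intro integral_le continuous_UNIV_integrable_on continuous_intros g continuous_on_compose2[OF g])
      show "g (y + t) \<le> g y + \<epsilon> / 2" for y using t(2)[of "y + t"] by (simp only: add_diff_cancel_right' abs_less_iff) linarith
    qed auto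
    moreover have "integral {b..b + L} (\<lambda>y. g y + \<epsilon> / 2) = integral {b..b + L} g + \<epsilon> / 2 * L"
      using \<open>L > 0\<close> int by (subst integral_add) auto
    moreover have "2 * (l * B) \<le> \<epsilon> / 2 * L"
      using L \<open>\<epsilon> > 0\<close> by (auto simp: L0_def field_simps)
    ultimately show ?thesis by (simp add: abs_le_iff)
  qed
  moreover have "L0 > 0" by (simp add: L0_def)
  ultimately show ?thesis by blast
qed

text \<open>By almost invariance the mean \<open>m\<close> over \<open>{-T..T}\<close>, a block of
  length \<open>2 * T\<close>, is within \<epsilon>/2 of the mean over every block of that length.
  So both \<open>g - (m + \<epsilon> / 2)\<close> and \<open>(m - \<epsilon> / 2) - g\<close> have
  nonpositive block integrals, and the one-sided estimate applies to each.\<close>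

lemma AE_scalar_average_near_mean:
  fixes g :: "real \<Rightarrow> real"
  assumes g: "uniformly_continuous_on UNIV g" and B: "\<And>x. \<bar>g x\<bar> \<le> B"
    and ap: "\<And>\<epsilon>. \<epsilon> > 0 \<Longrightarrow> \<exists>l>0. \<forall>a. \<exists>t\<in>{a..a + l}. \<forall>x. \<bar>g x - g (x - t)\<bar> < \<epsilon>"
    and "\<epsilon> > 0" and \<alpha>: "\<bar>\<alpha>\<bar> > 1"
  shows "\<exists>T0>0. \<forall>T\<ge>T0. AE x in lebesgue. \<forall>\<^sub>F N in sequentially.
    \<bar>(1 / real N) * (\<Sum>n<N. g (\<alpha> ^ n * x)) - (1 / (2 * T)) * integral {-T..T} g\<bar> \<le> \<epsilon>"
proof -
  have gc: "continuous_on UNIV g" using g by (rule uniformly_continuous_imp_continuous)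
  obtain L0 where L0: "L0 > 0" "\<And>L a b. L \<ge> L0 \<Longrightarrow>
      integral {a..a + L} g \<le> integral {b..b + L} g + \<epsilon> / 2 * L"
    using integral_block_almost_invariant[OF gc B ap, of "\<epsilon> / 2"] \<open>\<epsilon> > 0\<close> by auto
  have "AE x in lebesgue. \<forall>\<^sub>F N in sequentially.
    \<bar>(1 / real N) * (\<Sum>n<N. g (\<alpha> ^ n * x)) - (1 / (2 * T)) * integral {-T..T} g\<bar> \<le> \<epsilon>"
    if T: "T \<ge> L0" for T
  proof -
    define m where "m = (1 / (2 * T)) * integral {-T..T} g"
    have T0: "T > 0" using T L0 by auto
    then have m: "integral {-T..-T + 2 * T} g = 2 * T * m" by (simp add: m_def)
    have near: "integral {c..c + 2 * T} g \<le> 2 * T * m + \<epsilon> / 2 * (2 * T)"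
      "2 * T * m \<le> integral {c..c + 2 * T} g + \<epsilon> / 2 * (2 * T)" for c
      using L0(2)[of "2 * T" c "-T"] L0(2)[of "2 * T" "-T" c] T T0 unfolding m by auto
    have "AE x in lebesgue. \<forall>\<^sub>F N in sequentially.
        (\<Sum>n<N. g (\<alpha> ^ n * x) - (m + \<epsilon> / 2)) \<le> \<epsilon> / 2 * real N"
    proof (rule AE_lacunary_average_le[where L = "2 * T" and B = "B + \<bar>m + \<epsilon> / 2\<bar>"])
      show "integral {c..c + 2 * T} (\<lambda>x. g x - (m + \<epsilon> / 2)) \<le> 0" for c
        using near(1)[of c] T0
        by (subst integral_diff) (auto intro!: continuous_UNIV_integrable_on gc simp: algebra_simps)
      show "\<bar>g x - (m + \<epsilon> / 2)\<bar> \<le> B + \<bar>m + \<epsilon> / 2\<bar>" for x using B[of x] by linarith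
    qed (use T0 \<open>\<epsilon> > 0\<close> \<alpha> in \<open>auto intro!: uniformly_continuous_on_diff g uniformly_continuous_on_const\<close>)
    moreover have "AE x in lebesgue. \<forall>\<^sub>F N in sequentially.
        (\<Sum>n<N. (m - \<epsilon> / 2) - g (\<alpha> ^ n * x)) \<le> \<epsilon> / 2 * real N"
    proof (rule AE_lacunary_average_le[where L = "2 * T" and B = "B + \<bar>m - \<epsilon> / 2\<bar>"])
      show "integral {c..c + 2 * T} (\<lambda>x. (m - \<epsilon> / 2) - g x) \<le> 0" for c
        using near(2)[of c] T0
        by (subst integral_diff) (auto intro!: continuous_UNIV_integrable_on gc simp: algebra_simps)
      show "\<bar>(m - \<epsilon> / 2) - g x\<bar> \<le> B + \<bar>m - \<epsilon> / 2\<bar>" for x using B[of x] by linarith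
    qed (use T0 \<open>\<epsilon> > 0\<close> \<alpha> in \<open>auto intro!: uniformly_continuous_on_diff g uniformly_continuous_on_const\<close>)
    ultimately show ?thesis
    proof eventually_elim
      case (elim x)
      show ?case using elim eventually_gt_at_top[of 0]
      proof eventually_elim
        case (elim N)
        define S where "S = (\<Sum>n<N. g (\<alpha> ^ n * x))"
        have "S \<le> (m + \<epsilon>) * real N" "(m - \<epsilon>) * real N \<le> S"
          using elim(1,2) unfolding sum_subtractf S_def[symmetric] by (auto simp: algebra_simps)
        then have "S / real N \<le> m + \<epsilon>" "m - \<epsilon> \<le> S / real N"
          using elim(3) by (auto simp: divide_le_eq le_divide_eq)
        then show ?case unfolding m_def[symmetric] S_def[symmetric] by (simp add: abs_le_iff)
      qed
    qed
  qed
  with L0(1) show ?thesis by blast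
qed

section \<open>Almost periodic functions\<close>

text \<open>Tent functions around the points of a finite \<open>e\<close>-net, divided by their sum
  \<open>S\<close>, form a partition of unity. A weight vanishes unless its centre is within
  \<open>e\<close> of \<open>y\<close>, so \<open>y\<close> is approximated by a convex combination
  of nearby centres. Continuity is claimed on \<open>K\<close> only because \<open>S\<close> may
  vanish elsewhere.\<close>

lemma compact_finite_rank_approximation:
  fixes K :: "'a::real_normed_vector set"
  assumes "compact K" and "e > 0"
  obtains I and \<phi> :: "'a \<Rightarrow> 'a \<Rightarrow> real" where "finite I" "\<And>v. continuous_on K (\<phi> v)"
    "\<And>y. y \<in> K \<Longrightarrow> norm (y - (\<Sum>v\<in>I. \<phi> v y *\<^sub>R v)) \<le> e"
proof -
  obtain I where I: "finite I" "K \<subseteq> (\<Union>v\<in>I. ball v e)"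
    using assms unfolding compact_eq_totally_bounded by blast
  define \<psi> where "\<psi> v y = max 0 (e - norm (y - v))" for v y :: 'a
  define S where "S y = (\<Sum>v\<in>I. \<psi> v y)" for y
  have \<psi>0: "\<psi> v y \<ge> 0" for v y by (simp add: \<psi>_def)
  have S: "S y > 0" if "y \<in> K" for y
  proof -
    obtain v where "v \<in> I" "dist v y < e" using I(2) \<open>y \<in> K\<close> by auto
    then have "v \<in> I" "\<psi> v y > 0" by (auto simp: \<psi>_def dist_norm norm_minus_commute)
    then show ?thesis unfolding S_def using I(1) \<psi>0 by (intro sum_pos2) auto
  qed
  have \<psi>c: "continuous_on K (\<psi> v)" for v
    unfolding \<psi>_def by (intro continuous_intros)
  show ?thesis
  proof
    show "finite I" by fact
    show "continuous_on K (\<lambda>y. \<psi> v y / S y)" for v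
      unfolding S_def using S by (intro continuous_intros \<psi>c) (fastforce simp: S_def)
    show "norm (y - (\<Sum>v\<in>I. (\<psi> v y / S y) *\<^sub>R v)) \<le> e" if "y \<in> K" for y
    proof -
      have 1: "(\<Sum>v\<in>I. \<psi> v y / S y) = 1"
        using S[OF that] by (simp add: S_def flip: sum_divide_distrib)
      have "y - (\<Sum>v\<in>I. (\<psi> v y / S y) *\<^sub>R v) = (\<Sum>v\<in>I. (\<psi> v y / S y) *\<^sub>R (y - v))"
        by (simp add: scaleR_diff_right sum_subtractf 1 flip: scaleR_sum_left)
      also have "norm \<dots> \<le> (\<Sum>v\<in>I. (\<psi> v y / S y) * e)"
      proof (intro sum_norm_le)
        fix v
        have "norm (y - v) \<le> e \<or> \<psi> v y = 0" by (auto simp: \<psi>_def)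
        then show "norm ((\<psi> v y / S y) *\<^sub>R (y - v)) \<le> \<psi> v y / S y * e"
          using S[OF that] \<psi>0[of v y] by (elim disjE) (auto intro!: divide_right_mono mult_left_mono)
      qed
      also have "\<dots> = e" by (simp only: 1 mult_1 flip: sum_distrib_right)
      finally show ?thesis .
    qed
  qed
qed

section \<open>Uniform continuity and relatively compact range\<close>

lemma Bohr_almost_periodic_almost_periods:
  assumes "Bohr_almost_periodic f" and "\<epsilon> > 0"
  shows "\<exists>l>0. \<forall>a. \<exists>t\<in>{a..a + l}. \<forall>x. norm (f x - f (x - t)) < \<epsilon>"
proof -
  have "relatively_dense {t. (SUP x. ereal (norm (f x - f (x - t)))) < ereal \<epsilon>}"
    using assms by (auto simp: Bohr_almost_periodic_def)
  then obtain l where l: "l > 0"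
    "\<And>a. {t. (SUP x. ereal (norm (f x - f (x - t)))) < ereal \<epsilon>} \<inter> {a..a + l} \<noteq> {}"
    unfolding relatively_dense_def by blast
  have "\<exists>t\<in>{a..a + l}. \<forall>x. norm (f x - f (x - t)) < \<epsilon>" for a
  proof -
    obtain t where t: "t \<in> {a..a + l}" "(SUP x. ereal (norm (f x - f (x - t)))) < ereal \<epsilon>"
      using l(2)[of a] by blast
    have "ereal (norm (f x - f (x - t))) < ereal \<epsilon>" for x
      using SUP_upper[of x UNIV "\<lambda>x. ereal (norm (f x - f (x - t)))"] t(2)
      by (meson UNIV_I le_less_trans)
    with t(1) show ?thesis by (intro bexI[of _ t]) auto
  qed
  with l(1) show ?thesis by blast
qed

text \<open>An almost period in \<open>{x - l..x}\<close> moves \<open>x\<close> into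
  \<open>{0..l}\<close> and every \<open>y\<close> at distance below 1 into
  \<open>{-1..l + 1}\<close>, where Heine-Cantor applies. The two shifts by this common
  \<open>t\<close> and the compact estimate cost \<epsilon>/3 each.\<close>

lemma Bohr_almost_periodic_uniformly_continuous:
  assumes f: "Bohr_almost_periodic f"
  shows "uniformly_continuous_on UNIV f"
  unfolding uniformly_continuous_on_def
proof (intro allI impI)
  fix \<epsilon> :: real assume "\<epsilon> > 0"
  then obtain l where l: "l > 0" "\<And>a. \<exists>t\<in>{a..a + l}. \<forall>x. norm (f x - f (x - t)) < \<epsilon> / 3"
    using Bohr_almost_periodic_almost_periods[OF f, of "\<epsilon> / 3"] by auto
  have "continuous_on {-1..l + 1} f"
    using f continuous_on_subset by (auto simp: Bohr_almost_periodic_def)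
  then have "uniformly_continuous_on {-1..l + 1} f"
    by (rule compact_uniformly_continuous) simp
  then obtain d where d: "d > 0"
    "\<And>x y. x \<in> {-1..l + 1} \<Longrightarrow> y \<in> {-1..l + 1} \<Longrightarrow> dist y x < d \<Longrightarrow> dist (f y) (f x) < \<epsilon> / 3"
    unfolding uniformly_continuous_on_def using \<open>\<epsilon> > 0\<close> by (metis divide_pos_pos zero_less_numeral)
  have "dist (f y) (f x) < \<epsilon>" if "dist y x < min d 1" for x y
  proof -
    obtain t where t: "t \<in> {x - l..x - l + l}" "\<And>z. norm (f z - f (z - t)) < \<epsilon> / 3" using l(2) by blast
    have "dist (f (y - t)) (f (x - t)) < \<epsilon> / 3"
      using that t(1) by (intro d(2)) (auto simp: dist_real_def abs_if split: if_splits)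
    moreover have "dist (f y) (f (y - t)) < \<epsilon> / 3" "dist (f x) (f (x - t)) < \<epsilon> / 3"
      using t(2) by (auto simp: dist_norm)
    ultimately show ?thesis
      by metric
  qed
  then show "\<exists>d>0. \<forall>x\<in>UNIV. \<forall>y\<in>UNIV. dist y x < d \<longrightarrow> dist (f y) (f x) < \<epsilon>"
    using d(1) by (intro exI[of _ "min d 1"]) auto
qed

text \<open>Up to \<epsilon>/3 every value of \<open>f\<close> is already taken on
  \<open>{0..l}\<close>, so a finite \<epsilon>/3-net of that compact image is an \<epsilon>-net of
  the closed range; passing to the closure uses the last third.\<close>

lemma Bohr_almost_periodic_compact_closure_range:
  fixes f :: "real \<Rightarrow> 'a::banach"
  assumes f: "Bohr_almost_periodic f"
  shows "compact (closure (range f))"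
  unfolding compact_eq_totally_bounded
proof (intro conjI allI impI)
  show "complete (closure (range f))" by (simp add: complete_eq_closed)
  fix \<epsilon> :: real assume "\<epsilon> > 0"
  then obtain l where l: "l > 0" "\<And>a. \<exists>t\<in>{a..a + l}. \<forall>x. norm (f x - f (x - t)) < \<epsilon> / 3"
    using Bohr_almost_periodic_almost_periods[OF f, of "\<epsilon> / 3"] by auto
  have "compact (f ` {0..l})"
    using f continuous_on_subset by (intro compact_continuous_image) (auto simp: Bohr_almost_periodic_def)
  then obtain k where k: "finite k" "f ` {0..l} \<subseteq> (\<Union>x\<in>k. ball x (\<epsilon> / 3))"
    using \<open>\<epsilon> > 0\<close> unfolding compact_eq_totally_bounded by (meson divide_pos_pos zero_less_numeral)
  have "closure (range f) \<subseteq> (\<Union>x\<in>k. ball x \<epsilon>)"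
  proof
    fix y assume "y \<in> closure (range f)"
    then obtain x where x: "dist (f x) y < \<epsilon> / 3"
      using \<open>\<epsilon> > 0\<close> by (metis closure_approachable divide_pos_pos rangeE zero_less_numeral)
    obtain t where t: "t \<in> {x - l..x - l + l}" "\<And>z. norm (f z - f (z - t)) < \<epsilon> / 3" using l(2) by blast
    have "f (x - t) \<in> (\<Union>x\<in>k. ball x (\<epsilon> / 3))" using t(1) by (intro subsetD[OF k(2)] imageI) auto
    then obtain v where v: "v \<in> k" "dist v (f (x - t)) < \<epsilon> / 3" by auto
    moreover have "dist (f x) (f (x - t)) < \<epsilon> / 3" using t(2) by (simp add: dist_norm)
    ultimately have "dist v y < \<epsilon>" using x by metric
    with v(1) show "y \<in> (\<Union>x\<in>k. ball x \<epsilon>)" by auto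
  qed
  with k(1) show "\<exists>k. finite k \<and> closure (range f) \<subseteq> (\<Union>x\<in>k. ball x \<epsilon>)" by blast
qed

section \<open>The Bochner integral of a continuous function\<close>

text \<open>In a nonseparable space the difference of two Borel functions need not be Borel. Here
  \<open>s\<close> has finitely many values \<open>v\<close>, and on each level set the function is
  the norm of \<open>f x - v\<close>, a continuous function of \<open>f x\<close>.\<close>

lemma borel_measurable_norm_diff_simple_function:
  fixes f s :: "'a \<Rightarrow> 'b::real_normed_vector"
  assumes f: "f \<in> borel_measurable M" and s: "simple_function M s"
  shows "(\<lambda>x. norm (f x - s x)) \<in> borel_measurable M"
proof (rule measurable_compose_countable'[where f = "\<lambda>v x. norm (f x - v)" and g = s])
  show "(\<lambda>x. norm (f x - v)) \<in> borel_measurable M" for v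
    using f by (rule measurable_compose) (intro borel_measurable_continuous_onI continuous_intros)
  show "s \<in> measurable M (count_space (s ` space M))"
    using simple_functionD[OF s] by (subst measurable_count_space_eq2) auto
  show "countable (s ` space M)"
    using simple_functionD(1)[OF s] by (rule countable_finite)
qed

lemma simple_bochner_integral_diff_le:
  fixes f :: "'a \<Rightarrow> 'b::real_normed_vector"
  assumes f: "f \<in> borel_measurable M"
    and s: "Bochner_Integration.simple_bochner_integrable M s"
    and t: "Bochner_Integration.simple_bochner_integrable M t"
  shows "ennreal (norm (Bochner_Integration.simple_bochner_integral M s
        - Bochner_Integration.simple_bochner_integral M t))
    \<le> (\<integral>\<^sup>+ x. norm (f x - s x) \<partial>M) + (\<integral>\<^sup>+ x. norm (f x - t x) \<partial>M)"
proof -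
  let ?I = "Bochner_Integration.simple_bochner_integral M"
  have meas: "(\<lambda>x. ennreal (norm (f x - u x))) \<in> borel_measurable M"
    if "Bochner_Integration.simple_bochner_integrable M u" for u
  proof -
    have "simple_function M u" using that by cases
    from borel_measurable_norm_diff_simple_function[OF f this] show ?thesis by measurable
  qed
  have "ennreal (norm (?I s - ?I t)) = norm (?I (\<lambda>x. s x - t x))"
    using s t by (subst simple_bochner_integral_diff) auto
  also have "\<dots> \<le> ?I (\<lambda>x. norm (s x - t x))"
    using simple_bochner_integrable_compose2[of "(-)" M s t] s t
    by (auto intro!: simple_bochner_integral_norm_bound)
  also have "\<dots> = (\<integral>\<^sup>+ x. norm (s x - t x) \<partial>M)"
    using simple_bochner_integrable_compose2[of "\<lambda>x y. norm (x - y)" M s t] s t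
    by (auto intro!: simple_bochner_integral_eq_nn_integral)
  also have "\<dots> \<le> (\<integral>\<^sup>+ x. ennreal (norm (f x - s x)) + ennreal (norm (f x - t x)) \<partial>M)"
  proof (intro nn_integral_mono)
    fix x
    have "norm (s x - t x) \<le> norm (f x - s x) + norm (f x - t x)"
      using norm_triangle_ineq4[of "f x - t x" "f x - s x"] by (simp add: add.commute)
    then show "ennreal (norm (s x - t x)) \<le> ennreal (norm (f x - s x)) + ennreal (norm (f x - t x))"
      by (metis ennreal_leI ennreal_plus norm_ge_zero)
  qed
  also have "\<dots> = (\<integral>\<^sup>+ x. norm (f x - s x) \<partial>M) + (\<integral>\<^sup>+ x. norm (f x - t x) \<partial>M)"
    by (intro nn_integral_add meas s t)
  finally show ?thesis .
qed

text \<open>Makes the \<open>THE\<close> in \<open>Bochner_integral\<close> meaningful: the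
  integrals of two approximating sequences differ by at most the sum of their L1 distances to
  \<open>f\<close>, which tends to 0.\<close>

lemma has_Bochner_integral_unique:
  assumes "has_Bochner_integral M f x" and "has_Bochner_integral M f y"
  shows "x = y"
  using assms(1)
proof cases
  case s: (1 s)
  from assms(2) show ?thesis
  proof cases
    case t: (1 t)
    let ?I = "Bochner_Integration.simple_bochner_integral M"
    have bound: "(\<lambda>i. (\<integral>\<^sup>+ z. norm (f z - s i z) \<partial>M) + (\<integral>\<^sup>+ z. norm (f z - t i z) \<partial>M)) \<longlonglongrightarrow> 0 + 0"
      using s(3) t(3) by (intro tendsto_add)
    have diff: "(\<lambda>i. ennreal (norm (?I (s i) - ?I (t i)))) \<longlonglongrightarrow> ennreal (norm (x - y))"
      using s(4) t(4) by (intro tendsto_ennrealI tendsto_norm tendsto_diff)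
    have "ennreal (norm (x - y)) \<le> 0 + 0"
      by (rule LIMSEQ_le[OF diff bound]) (intro exI allI impI simple_bochner_integral_diff_le s t)
    then show ?thesis by simp
  qed
qed

lemma Bochner_integral_eqI:
  assumes "has_Bochner_integral M f x"
  shows "Bochner_integral M f = x"
proof -
  have "(THE y. has_Bochner_integral M f y) = x"
    using assms by (rule the_equality) (rule has_Bochner_integral_unique[OF _ assms])
  with assms show ?thesis unfolding Bochner_integral_def by auto
qed

text \<open>The bridge between the Bochner and the Henstock-Kurzweil integral: \<open>s\<close> is
  the finite sum of its values times indicators of its level sets.\<close>

lemma simple_function_has_integral:
  fixes s :: "real \<Rightarrow> 'a::banach"
  assumes "Bochner_Integration.simple_bochner_integrable lborel s"
  shows "(s has_integral Bochner_Integration.simple_bochner_integral lborel s) UNIV"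
proof -
  from assms have s: "simple_function lborel s" and fin: "emeasure lborel {y. s y \<noteq> 0} \<noteq> \<infinity>"
    by (auto elim: simple_bochner_integrable.cases)
  have finite: "finite (range s)" using simple_functionD(1)[OF s] by simp
  have level: "((\<lambda>x. if x \<in> {x. s x = y} then y else 0) has_integral measure lborel {x. s x = y} *\<^sub>R y) UNIV" for y
  \<comment> \<open>Level sets of nonzero values lie in the support of \<open>s\<close> and so have
    finite measure. The zero level set may be infinite, but its term is 0 on both sides.\<close>
  proof (cases "y = 0")
    case False
    have sets: "{x. s x = v} \<in> sets lborel" for v
      using simple_functionD(2)[OF s, of "{v}"] by (simp add: vimage_def)
    have "{x. s x \<noteq> 0} = UNIV - {x. s x = 0}" by auto
    then have "{x. s x \<noteq> 0} \<in> sets lborel" using sets[of 0] by auto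
    then have "emeasure lborel {x. s x = y} \<le> emeasure lborel {x. s x \<noteq> 0}"
      using False by (intro emeasure_mono) auto
    then have "emeasure lborel {x. s x = y} < \<infinity>"
      using fin by (simp add: top.not_eq_extremum order.strict_trans1)
    then have "((\<lambda>x. 1) has_integral measure lborel {x. s x = y}) {x. s x = y}"
      using sets[of y] by (intro has_integral_measure_lborel) auto
    from has_integral_scaleR_left[OF this, of y] show ?thesis
      by (intro has_integral_restrict_UNIV[THEN iffD2]) simp
  next
    case True
    then show ?thesis by (simp cong: if_cong)
  qed
  have "((\<lambda>x. \<Sum>y\<in>range s. if x \<in> {x. s x = y} then y else 0) has_integral
      (\<Sum>y\<in>range s. measure lborel {x. s x = y} *\<^sub>R y)) UNIV"
    by (intro has_integral_sum finite level)
  moreover have "(\<Sum>y\<in>range s. if x \<in> {x. s x = y} then y else 0) = s x" for x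
    using finite by simp
  ultimately show ?thesis
    by (simp add: Bochner_Integration.simple_bochner_integral_def)
qed

text \<open>Sampling \<open>f\<close> on a grid of mesh \<open>1 / Suc n\<close> gives simple
  functions that converge uniformly on the interval. Uniform closeness controls both the L1 error
  and the distance of the simple integrals to the Henstock-Kurzweil integral.\<close>

lemma has_Bochner_integral_continuous_on:
  fixes f :: "real \<Rightarrow> 'a::banach"
  assumes f: "continuous_on {a..b} f" and "a \<le> b"
  shows "has_Bochner_integral lborel (\<lambda>y. indicator {a..b} y *\<^sub>R f y) (integral {a..b} f)"
proof -
  \<comment> \<open>Clamping \<open>y\<close> to the interval bounds the integer
    \<open>c n y\<close> on the whole line, so that it takes finitely many values. The
    \<open>max a\<close> in \<open>p\<close> corrects a grid point that falls to the left of
    \<open>a\<close>.\<close>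
  define c where "c n y = \<lfloor>real (Suc n) * min b (max a y)\<rfloor>" for n y
  define p where "p n y = max a (of_int (c n y) / real (Suc n))" for n y
  define s where "s n y = (if y \<in> {a..b} then f (p n y) else 0)" for n y
  have p: "p n y \<in> {a..b}" "\<bar>p n y - y\<bar> \<le> 1 / real (Suc n)" if "y \<in> {a..b}" for n y
  proof -
    define q where "q = of_int (c n y) / real (Suc n)"
    have "of_int (c n y) \<le> real (Suc n) * y" "real (Suc n) * y \<le> of_int (c n y) + 1"
      using that floor_correct[of "real (Suc n) * y"] by (auto simp: c_def)
    then have "q \<le> y" "y \<le> (of_int (c n y) + 1) / real (Suc n)"
      by (simp_all add: q_def pos_le_divide_eq pos_divide_le_eq mult.commute del: of_nat_Suc)
    then have q: "q \<le> y" "y - q \<le> 1 / real (Suc n)"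
      by (simp_all add: q_def add_divide_distrib del: of_nat_Suc)
    then show "p n y \<in> {a..b}" "\<bar>p n y - y\<bar> \<le> 1 / real (Suc n)"
      using that unfolding p_def q_def[symmetric] by (auto simp: max_def abs_if)
  qed
  have simple: "simple_function lborel (s n)" for n
  proof -
    have "c n \<in> measurable lborel (count_space UNIV)" unfolding c_def by measurable
    moreover have "c n ` space lborel \<subseteq> {\<lfloor>real (Suc n) * a\<rfloor>..\<lfloor>real (Suc n) * b\<rfloor>}"
      using \<open>a \<le> b\<close> by (auto simp: c_def intro!: floor_mono mult_left_mono)
    then have "finite (c n ` space lborel)" by (rule finite_subset) simp
    ultimately have "simple_function lborel (c n)"
      unfolding simple_function_def using measurable_sets[of "c n" lborel "count_space UNIV"] by auto
    then have "simple_function lborel (\<lambda>y. f (max a (of_int (c n y) / real (Suc n))))"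
      by (rule simple_function_compose1)
    then show ?thesis
      unfolding s_def p_def by (intro simple_function_If_set) auto
  qed
  have integrable: "Bochner_Integration.simple_bochner_integrable lborel (s n)" for n
  proof
    have "emeasure lborel {y \<in> space lborel. s n y \<noteq> 0} \<le> emeasure lborel {a..b}"
      by (intro emeasure_mono) (auto simp: s_def)
    then show "emeasure lborel {y \<in> space lborel. s n y \<noteq> 0} \<noteq> \<infinity>"
      using \<open>a \<le> b\<close> by (auto simp: top_unique)
  qed (rule simple)
  have close: "\<forall>\<^sub>F n in sequentially. \<forall>y\<in>{a..b}. norm (f y - s n y) \<le> \<eta>" if "\<eta> > 0" for \<eta>
  proof -
    have "uniformly_continuous_on {a..b} f" by (intro compact_uniformly_continuous f) simp
    then obtain d where d: "d > 0"
      "\<And>x y. x \<in> {a..b} \<Longrightarrow> y \<in> {a..b} \<Longrightarrow> dist y x < d \<Longrightarrow> dist (f y) (f x) < \<eta>"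
      unfolding uniformly_continuous_on_def using \<open>\<eta> > 0\<close> by metis
    have "\<forall>\<^sub>F n in sequentially. 1 / real (Suc n) < d"
      using LIMSEQ_Suc[OF lim_1_over_n] \<open>d > 0\<close> by (intro order_tendstoD) auto
    then show ?thesis
    proof eventually_elim
      case (elim n)
      show ?case
      proof
        fix y assume y: "y \<in> {a..b}"
        have "dist (f y) (f (p n y)) < \<eta>"
          using p[OF y, of n] y elim by (intro d(2)) (auto simp: dist_real_def)
        then show "norm (f y - s n y) \<le> \<eta>" using y by (simp add: s_def dist_norm)
      qed
    qed
  qed
  show ?thesis
  proof
    show "(\<lambda>y. indicator {a..b} y *\<^sub>R f y) \<in> borel_measurable lborel"
      using f by (simp add: borel_measurable_continuous_on_indicator)
    show "Bochner_Integration.simple_bochner_integrable lborel (s n)" for n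
      by (rule integrable)
    show "(\<lambda>n. \<integral>\<^sup>+y. norm (indicator {a..b} y *\<^sub>R f y - s n y) \<partial>lborel) \<longlonglongrightarrow> 0"
    proof (rule order_tendstoI)
      fix e :: ennreal assume "0 < e"
      then obtain z where "0 < z" "z < e" using dense by blast
      then obtain r where r: "r > 0" "ennreal r < e" by (cases z) auto
      \<comment> \<open>The summand 1 keeps the denominator positive when
        \<open>a = b\<close>.\<close>
      define \<eta> where "\<eta> = r / (b - a + 1)"
      have \<eta>: "\<eta> > 0" "\<eta> * (b - a) \<le> r"
        using r(1) \<open>a \<le> b\<close> by (auto simp: \<eta>_def field_simps)
      from close[OF \<eta>(1)]
      show "\<forall>\<^sub>F n in sequentially. (\<integral>\<^sup>+y. norm (indicator {a..b} y *\<^sub>R f y - s n y) \<partial>lborel) < e"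
      proof eventually_elim
        case (elim n)
        have "(\<integral>\<^sup>+y. norm (indicator {a..b} y *\<^sub>R f y - s n y) \<partial>lborel)
            \<le> (\<integral>\<^sup>+y. ennreal \<eta> * indicator {a..b} y \<partial>lborel)"
          using elim by (intro nn_integral_mono) (auto simp: s_def intro!: ennreal_leI split: split_indicator)
        also have "\<dots> = ennreal (\<eta> * (b - a))"
          using \<open>a \<le> b\<close> \<eta>(1) by (subst nn_integral_cmult_indicator) (auto simp: ennreal_mult)
        also have "\<dots> \<le> ennreal r" using \<eta>(2) by (rule ennreal_leI)
        finally show ?case using r(2) by (rule order.strict_trans1)
      qed
    qed simp
    show "(\<lambda>n. Bochner_Integration.simple_bochner_integral lborel (s n)) \<longlonglongrightarrow> integral {a..b} f"
    proof (rule tendstoI)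
      fix e :: real assume "e > 0"
      define \<eta> where "\<eta> = e / (b - a + 1)"
      have \<eta>: "\<eta> > 0" "\<eta> * (b - a) < e"
        using \<open>e > 0\<close> \<open>a \<le> b\<close> by (auto simp: \<eta>_def field_simps)
      from close[OF \<eta>(1)]
      show "\<forall>\<^sub>F n in sequentially.
          dist (Bochner_Integration.simple_bochner_integral lborel (s n)) (integral {a..b} f) < e"
      proof eventually_elim
        case (elim n)
        let ?I = "Bochner_Integration.simple_bochner_integral lborel (s n)"
        have "((\<lambda>y. if y \<in> {a..b} then s n y else 0) has_integral ?I) UNIV"
          using simple_function_has_integral[OF integrable, of n]
          by (rule has_integral_eq[rotated]) (auto simp: s_def)
        then have "(s n has_integral ?I) {a..b}" by (simp only: has_integral_restrict_UNIV)
        then have "((\<lambda>y. f y - s n y) has_integral integral {a..b} f - ?I) {a..b}"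
          using f by (intro has_integral_diff integrable_integral integrable_continuous_real)
        from has_integral_bound_real[OF _ _ this, of \<eta> "{}"]
        have "norm (integral {a..b} f - ?I) \<le> \<eta> * (b - a)"
          using elim \<eta>(1) \<open>a \<le> b\<close> by simp
        with \<eta>(2) show ?case by (simp add: dist_norm norm_minus_commute)
      qed
    qed
  qed
qed

section \<open>Convergence of the averages\<close>

text \<open>Orbit averages and interval means do not increase the sup norm, so replacing
  \<open>f\<close> by the finite sum \<open>P\<close> costs \<epsilon>/3 in each. The last third
  covers \<open>P\<close>, whose coordinates \<open>g v\<close> are handled by the scalar
  result.\<close>

lemma AE_average_near_mean:
  fixes f :: "real \<Rightarrow> 'a::banach"
  assumes f: "Bohr_almost_periodic f" and \<alpha>: "\<bar>\<alpha>\<bar> > 1" and "\<epsilon> > 0"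
  shows "\<exists>T0>0. \<forall>T\<ge>T0. AE x in lebesgue. \<forall>\<^sub>F N in sequentially.
    norm ((1 / real N) *\<^sub>R (\<Sum>n<N. f (\<alpha> ^ n * x)) - (1 / (2 * T)) *\<^sub>R integral {-T..T} f) \<le> \<epsilon>"
proof -
  define K where "K = closure (range f)"
  have K: "compact K" unfolding K_def using f by (rule Bohr_almost_periodic_compact_closure_range)
  have fK: "f x \<in> K" for x unfolding K_def by (rule subsetD[OF closure_subset rangeI])
  have fu: "uniformly_continuous_on UNIV f" using f by (rule Bohr_almost_periodic_uniformly_continuous)
  then have fc: "continuous_on UNIV f" by (rule uniformly_continuous_imp_continuous)
  obtain I and \<phi> :: "'a \<Rightarrow> 'a \<Rightarrow> real" where I: "finite I" and \<phi>c: "\<And>v. continuous_on K (\<phi> v)"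
    and \<phi>: "\<And>y. y \<in> K \<Longrightarrow> norm (y - (\<Sum>v\<in>I. \<phi> v y *\<^sub>R v)) \<le> \<epsilon> / 3"
    using compact_finite_rank_approximation[OF K, of "\<epsilon> / 3"] \<open>\<epsilon> > 0\<close> by auto
  define g where "g v x = \<phi> v (f x)" for v x
  define P where "P x = (\<Sum>v\<in>I. g v x *\<^sub>R v)" for x
  have fP: "norm (f x - P x) \<le> \<epsilon> / 3" for x using \<phi>[OF fK] by (simp add: P_def g_def)
  have \<phi>u: "uniformly_continuous_on K (\<phi> v)" for v
    by (intro compact_uniformly_continuous \<phi>c K)
  have gu: "uniformly_continuous_on UNIV (g v)" for v
  proof -
    have "uniformly_continuous_on (range f) (\<phi> v)"
      unfolding uniformly_continuous_on_def
    proof (intro allI impI)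
      fix e :: real assume "e > 0"
      then obtain d where "d > 0" "\<forall>x\<in>K. \<forall>y\<in>K. dist y x < d \<longrightarrow> dist (\<phi> v y) (\<phi> v x) < e"
        using \<phi>u[of v] unfolding uniformly_continuous_on_def by blast
      with fK show "\<exists>d>0. \<forall>x\<in>range f. \<forall>y\<in>range f. dist y x < d \<longrightarrow> dist (\<phi> v y) (\<phi> v x) < e"
        by (intro exI[of _ d]) auto
    qed
    from uniformly_continuous_on_compose[OF fu this] show ?thesis by (simp add: g_def[abs_def])
  qed
  have gc: "continuous_on UNIV (g v)" for v using gu by (rule uniformly_continuous_imp_continuous)
  have Pc: "continuous_on UNIV P" unfolding P_def by (intro continuous_intros gc)
  have gB: "\<exists>B. \<forall>x. \<bar>g v x\<bar> \<le> B" for v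
  proof -
    have "bounded (\<phi> v ` K)" by (intro compact_imp_bounded compact_continuous_image \<phi>c K)
    then obtain B where "\<forall>z\<in>\<phi> v ` K. norm z \<le> B" unfolding bounded_iff by blast
    then show ?thesis using fK by (auto simp: g_def)
  qed
  \<comment> \<open>By uniform continuity of \<open>\<phi> v\<close> on \<open>K\<close>, the almost
    periods of \<open>f\<close> for a suitable \<open>d\<close> are almost periods of
    \<open>g v\<close> for \<open>e\<close>.\<close>
  have gap: "\<exists>l>0. \<forall>a. \<exists>t\<in>{a..a + l}. \<forall>x. \<bar>g v x - g v (x - t)\<bar> < e" if "e > 0" for v e
  proof -
    obtain d where d: "d > 0" "\<And>x y. x \<in> K \<Longrightarrow> y \<in> K \<Longrightarrow> dist y x < d \<Longrightarrow> dist (\<phi> v y) (\<phi> v x) < e"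
      using \<phi>u[of v] \<open>e > 0\<close> unfolding uniformly_continuous_on_def by metis
    obtain l where l: "l > 0" "\<And>a. \<exists>t\<in>{a..a + l}. \<forall>x. norm (f x - f (x - t)) < d"
      using Bohr_almost_periodic_almost_periods[OF f d(1)] by auto
    have "\<exists>t\<in>{a..a + l}. \<forall>x. \<bar>g v x - g v (x - t)\<bar> < e" for a
    proof -
      obtain t where t: "t \<in> {a..a + l}" "\<And>x. norm (f x - f (x - t)) < d" using l(2) by blast
      have "\<bar>g v x - g v (x - t)\<bar> < e" for x
        using d(2)[OF fK fK, of x "x - t"] t(2) by (simp add: g_def dist_norm)
      with t(1) show ?thesis by blast
    qed
    with l(1) show ?thesis by blast
  qed
  \<comment> \<open>The summand 1 keeps \<open>C\<close> positive even if all vectors in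
    \<open>I\<close> vanish or \<open>I\<close> is empty.\<close>
  define C where "C = (\<Sum>v\<in>I. norm v) + 1"
  have C: "C > 0" by (simp add: C_def sum_nonneg add_nonneg_pos)
  define \<delta> where "\<delta> = \<epsilon> / (3 * C)"
  have \<delta>: "\<delta> > 0" using C \<open>\<epsilon> > 0\<close> by (simp add: \<delta>_def)
  have \<delta>C: "(\<Sum>v\<in>I. \<delta> * norm v) \<le> \<epsilon> / 3"
  proof -
    have "(\<Sum>v\<in>I. \<delta> * norm v) \<le> \<delta> * C" using \<delta> by (simp add: C_def flip: sum_distrib_left)
    also have "\<dots> = \<epsilon> / 3" using C by (simp add: \<delta>_def)
    finally show ?thesis .
  qed
  have "\<forall>v. \<exists>T0>0. \<forall>T\<ge>T0. AE x in lebesgue. \<forall>\<^sub>F N in sequentially.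
      \<bar>(1 / real N) * (\<Sum>n<N. g v (\<alpha> ^ n * x)) - (1 / (2 * T)) * integral {-T..T} (g v)\<bar> \<le> \<delta>"
  proof
    fix v
    obtain B where "\<And>x. \<bar>g v x\<bar> \<le> B" using gB by blast
    then show "\<exists>T0>0. \<forall>T\<ge>T0. AE x in lebesgue. \<forall>\<^sub>F N in sequentially.
      \<bar>(1 / real N) * (\<Sum>n<N. g v (\<alpha> ^ n * x)) - (1 / (2 * T)) * integral {-T..T} (g v)\<bar> \<le> \<delta>"
      by (rule AE_scalar_average_near_mean[OF gu _ gap \<delta> \<alpha>])
  qed
  from choice[OF this] obtain T0 where T0: "\<And>v. T0 v > 0" "\<And>v T. T \<ge> T0 v \<Longrightarrow>
      AE x in lebesgue. \<forall>\<^sub>F N in sequentially.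
      \<bar>(1 / real N) * (\<Sum>n<N. g v (\<alpha> ^ n * x)) - (1 / (2 * T)) * integral {-T..T} (g v)\<bar> \<le> \<delta>"
    by blast
  \<comment> \<open>The thresholds are positive, so their finite sum dominates each of them; the 1
    covers an empty \<open>I\<close>.\<close>
  define T1 where "T1 = 1 + (\<Sum>v\<in>I. T0 v)"
  have T1: "T1 > 0" using T0(1) by (simp add: T1_def sum_nonneg less_imp_le add_pos_nonneg)
  have T1v: "T0 v \<le> T1" if "v \<in> I" for v
    using member_le_sum[OF that, of T0] T0(1) I by (simp add: T1_def less_imp_le)
  have "AE x in lebesgue. \<forall>\<^sub>F N in sequentially.
    norm ((1 / real N) *\<^sub>R (\<Sum>n<N. f (\<alpha> ^ n * x)) - (1 / (2 * T)) *\<^sub>R integral {-T..T} f) \<le> \<epsilon>"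
    if T: "T \<ge> T1" for T
  proof -
    have "T > 0" using T T1 by auto
    have "AE x in lebesgue. \<forall>v\<in>I. \<forall>\<^sub>F N in sequentially.
      \<bar>(1 / real N) * (\<Sum>n<N. g v (\<alpha> ^ n * x)) - (1 / (2 * T)) * integral {-T..T} (g v)\<bar> \<le> \<delta>"
      using T T1v I by (intro AE_finite_allI T0(2)) (auto intro: order_trans)
    then show ?thesis
    proof eventually_elim
      case (elim x)
      then have "\<forall>\<^sub>F N in sequentially. \<forall>v\<in>I.
        \<bar>(1 / real N) * (\<Sum>n<N. g v (\<alpha> ^ n * x)) - (1 / (2 * T)) * integral {-T..T} (g v)\<bar> \<le> \<delta>"
        using I by (intro eventually_ball_finite) auto
      then show ?case using eventually_gt_at_top[of 0]
      proof eventually_elim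
        case (elim N)
        define A where "A h = (1 / real N) *\<^sub>R (\<Sum>n<N. h (\<alpha> ^ n * x))" for h :: "real \<Rightarrow> 'a"
        define m where "m h = (1 / (2 * T)) *\<^sub>R integral {-T..T} h" for h :: "real \<Rightarrow> 'a"
        have 1: "norm (A f - A P) \<le> \<epsilon> / 3"
        proof -
          have "A f - A P = (1 / real N) *\<^sub>R (\<Sum>n<N. f (\<alpha> ^ n * x) - P (\<alpha> ^ n * x))"
            by (simp add: A_def sum_subtractf scaleR_diff_right)
          also have "norm \<dots> \<le> (1 / real N) * (\<Sum>n<N. \<epsilon> / 3)"
            unfolding norm_scaleR by (intro mult_mono sum_norm_le fP) auto
          finally show ?thesis using elim(2) by simp
        qed
        have 2: "norm (m P - m f) \<le> \<epsilon> / 3"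
        proof -
          have "m f - m P = (1 / (2 * T)) *\<^sub>R integral {-T..T} (\<lambda>y. f y - P y)"
            unfolding m_def
            by (subst integral_diff) (auto intro!: continuous_UNIV_integrable_on fc Pc simp: scaleR_diff_right)
          also have "norm \<dots> \<le> (1 / (2 * T)) * (\<epsilon> / 3 * (T - (-T)))"
            unfolding norm_scaleR using \<open>T > 0\<close> fP
            by (intro mult_mono integral_bound continuous_intros)
               (auto intro: continuous_on_subset[OF fc] continuous_on_subset[OF Pc])
          finally show ?thesis using \<open>T > 0\<close> by (simp add: norm_minus_commute)
        qed
        have 3: "norm (A P - m P) \<le> \<epsilon> / 3"
        proof -
          have "A P = (\<Sum>v\<in>I. ((1 / real N) * (\<Sum>n<N. g v (\<alpha> ^ n * x))) *\<^sub>R v)"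
            unfolding A_def P_def
            by (subst sum.swap) (simp add: scaleR_sum_right scaleR_sum_left sum_distrib_left)
          moreover have "integral {-T..T} P = (\<Sum>v\<in>I. integral {-T..T} (g v) *\<^sub>R v)"
            unfolding P_def
            by (intro integral_unique has_integral_sum I has_integral_scaleR_left
                integrable_integral continuous_UNIV_integrable_on gc)
          then have "m P = (\<Sum>v\<in>I. ((1 / (2 * T)) * integral {-T..T} (g v)) *\<^sub>R v)"
            by (simp add: m_def scaleR_sum_right)
          ultimately have "A P - m P = (\<Sum>v\<in>I. ((1 / real N) * (\<Sum>n<N. g v (\<alpha> ^ n * x))
              - (1 / (2 * T)) * integral {-T..T} (g v)) *\<^sub>R v)"
            by (simp only: scaleR_diff_left sum_subtractf)
          also have "norm \<dots> \<le> (\<Sum>v\<in>I. \<delta> * norm v)"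
            using elim(1)
            by (intro sum_norm_le) (simp only: norm_scaleR real_norm_def mult_right_mono norm_ge_zero)
          finally show ?thesis using \<delta>C by linarith
        qed
        have "norm (A f - m f) = norm ((A f - A P) + (A P - m P) + (m P - m f))" by simp
        also have "\<dots> \<le> norm ((A f - A P) + (A P - m P)) + norm (m P - m f)"
          by (rule norm_triangle_ineq)
        also have "\<dots> \<le> norm (A f - A P) + norm (A P - m P) + norm (m P - m f)"
          by (intro add_right_mono norm_triangle_ineq)
        finally have "norm (A f - m f) \<le> norm (A f - A P) + norm (A P - m P) + norm (m P - m f)" .
        with 1 2 3 show ?case unfolding A_def m_def by linarith
      qed
    qed
  qed
  with T1 show ?thesis by blast
qed

lemma AE_lebesgue_exists:
  assumes "AE x::real in lebesgue. P x"
  shows "\<exists>x. P x"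
proof (rule ccontr)
  assume "\<nexists>x. P x"
  then have "{x. \<not> P x} = UNIV" by auto
  with assms show False
    unfolding eventually_ae_filter_negligible by (metis non_negligible_UNIV top.extremum_unique)
qed

theorem theorem5p2:
  fixes f :: "real \<Rightarrow> 'a::banach" and \<alpha> :: real
  assumes "Bohr_almost_periodic f" and "\<bar>\<alpha>\<bar> > 1"
  shows "AE x in lebesgue.
    (\<lambda>N. (1 / real N) *\<^sub>R (\<Sum>n<N. f (\<alpha> ^ n * x))) \<longlonglongrightarrow> mean f"
proof -
  define A where "A x N = (1 / real N) *\<^sub>R (\<Sum>n<N. f (\<alpha> ^ n * x))" for x N
  define m where "m T = (1 / (2 * T)) *\<^sub>R integral {-T..T} f" for T
  have near: "\<exists>T0>0. \<forall>T\<ge>T0. AE x in lebesgue. \<forall>\<^sub>F N in sequentially. norm (A x N - m T) \<le> \<epsilon>"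
    if "\<epsilon> > 0" for \<epsilon>
    using AE_average_near_mean[OF assms that] unfolding A_def m_def .
  have Cauchy: "\<exists>T0. \<forall>T\<ge>T0. \<forall>T'\<ge>T0. norm (m T - m T') \<le> \<epsilon>" if "\<epsilon> > 0" for \<epsilon>
  proof -
    obtain T0 where T0: "\<And>T. T \<ge> T0 \<Longrightarrow>
        AE x in lebesgue. \<forall>\<^sub>F N in sequentially. norm (A x N - m T) \<le> \<epsilon> / 2"
      using near[of "\<epsilon> / 2"] \<open>\<epsilon> > 0\<close> by auto
    have "norm (m T - m T') \<le> \<epsilon>" if "T \<ge> T0" "T' \<ge> T0" for T T'
    proof -
      \<comment> \<open>The null sets depend on \<open>T\<close>, but two of them cannot cover the
        line. One point \<open>x\<close> and one large \<open>N\<close> then give an average close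
        to both means.\<close>
      have "AE x in lebesgue. (\<forall>\<^sub>F N in sequentially. norm (A x N - m T) \<le> \<epsilon> / 2)
          \<and> (\<forall>\<^sub>F N in sequentially. norm (A x N - m T') \<le> \<epsilon> / 2)"
        using T0[OF that(1)] T0[OF that(2)] by eventually_elim blast
      then have "\<exists>x. (\<forall>\<^sub>F N in sequentially. norm (A x N - m T) \<le> \<epsilon> / 2)
          \<and> (\<forall>\<^sub>F N in sequentially. norm (A x N - m T') \<le> \<epsilon> / 2)"
        by (rule AE_lebesgue_exists)
      then obtain x where "\<forall>\<^sub>F N in sequentially. norm (A x N - m T) \<le> \<epsilon> / 2"
          "\<forall>\<^sub>F N in sequentially. norm (A x N - m T') \<le> \<epsilon> / 2"
        by blast
      then have "\<forall>\<^sub>F N in sequentially. norm (A x N - m T) \<le> \<epsilon> / 2 \<and> norm (A x N - m T') \<le> \<epsilon> / 2"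
        by (rule eventually_conj)
      then obtain N where "norm (A x N - m T) \<le> \<epsilon> / 2" "norm (A x N - m T') \<le> \<epsilon> / 2"
        using eventually_happens'[OF sequentially_bot] by blast
      then show ?thesis
        using norm_triangle_ineq4[of "A x N - m T'" "A x N - m T"] by simp
    qed
    then show ?thesis by blast
  qed
  have "Cauchy (\<lambda>n. m (real n))"
  proof (rule CauchyI)
    fix e :: real assume "e > 0"
    obtain T0 where T0: "\<And>T T'. T \<ge> T0 \<Longrightarrow> T' \<ge> T0 \<Longrightarrow> norm (m T - m T') \<le> e / 2"
      using Cauchy[of "e / 2"] \<open>e > 0\<close> by auto
    obtain k where "real k \<ge> T0" using real_arch_simple by blast
    then show "\<exists>k. \<forall>i\<ge>k. \<forall>j\<ge>k. norm (m (real i) - m (real j)) < e"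
      using T0 \<open>e > 0\<close>
      by (intro exI[of _ k] allI impI order.strict_trans1[OF T0, of "real _" "real _"]) auto
  qed
  then obtain M where M: "(\<lambda>n. m (real n)) \<longlonglongrightarrow> M"
    using Cauchy_convergent convergentD by blast
  have lim: "(m \<longlongrightarrow> M) at_top"
  proof (rule tendstoI)
    fix e :: real assume "e > 0"
    obtain T0 where T0: "\<And>T T'. T \<ge> T0 \<Longrightarrow> T' \<ge> T0 \<Longrightarrow> norm (m T - m T') \<le> e / 2"
      using Cauchy[of "e / 2"] \<open>e > 0\<close> by auto
    \<comment> \<open>Letting \<open>T'\<close> run through the integers in the Cauchy estimate
      bounds the distance to \<open>M\<close> for every real \<open>T\<close> beyond
      \<open>T0\<close>.\<close>
    have "norm (m T - M) \<le> e / 2" if "T \<ge> T0" for T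
    proof (rule tendsto_upperbound)
      show "(\<lambda>n. norm (m T - m (real n))) \<longlonglongrightarrow> norm (m T - M)" by (intro tendsto_intros M)
      have "\<forall>\<^sub>F n in sequentially. real n \<ge> T0"
        using filterlim_real_sequentially by (simp add: filterlim_at_top)
      then show "\<forall>\<^sub>F n in sequentially. norm (m T - m (real n)) \<le> e / 2"
        by eventually_elim (use T0 that in auto)
    qed simp
    then show "\<forall>\<^sub>F T in at_top. dist (m T) M < e"
      using \<open>e > 0\<close> by (intro eventually_mono[OF eventually_ge_at_top[of T0]]) (fastforce simp: dist_norm)
  qed
  \<comment> \<open>The two forms of the mean are matched for \<open>T > 0\<close>, where
    \<open>{-T..T}\<close> is a proper interval; this suffices for a limit at infinity.\<close>
  have "mean f = M"
  proof -
    have "continuous_on {-T..T} f" for T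
      using assms(1) continuous_on_subset by (auto simp: Bohr_almost_periodic_def)
    then have "m T = (1 / (2 * T)) *\<^sub>R Bochner_integral lborel (\<lambda>y. indicator {-T..T} y *\<^sub>R f y)"
      if "T > 0" for T
      using that unfolding m_def
      by (subst Bochner_integral_eqI[OF has_Bochner_integral_continuous_on]) auto
    then have "((\<lambda>T. (1 / (2 * T)) *\<^sub>R Bochner_integral lborel (\<lambda>y. indicator {-T..T} y *\<^sub>R f y)) \<longlongrightarrow> M) at_top"
      by (intro Lim_transform_eventually[OF lim] eventually_mono[OF eventually_gt_at_top[of 0]])
    then show ?thesis unfolding mean_def by (intro tendsto_Lim) auto
  qed
  \<comment> \<open>Only countably many tolerances are used, so that their null sets can be united.
    For each \<open>k\<close> a single \<open>T\<close> with \<open>m T\<close> close to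
    \<open>M\<close> is fixed first, and the null set belongs to that \<open>T\<close>.\<close>
  have "AE x in lebesgue. \<forall>\<^sub>F N in sequentially. dist (A x N) M < inverse (real (Suc k))" for k
  proof -
    define e where "e = inverse (real (Suc k)) / 3"
    have "e > 0" by (simp add: e_def)
    obtain T0 where T0: "\<And>T. T \<ge> T0 \<Longrightarrow>
        AE x in lebesgue. \<forall>\<^sub>F N in sequentially. norm (A x N - m T) \<le> e"
      using near[OF \<open>e > 0\<close>] by auto
    have "\<forall>\<^sub>F T in at_top. T \<ge> T0 \<and> dist (m T) M < e"
      using tendstoD[OF lim \<open>e > 0\<close>] eventually_ge_at_top[of T0] by eventually_elim auto
    then obtain T where T: "T \<ge> T0" "dist (m T) M < e"
      using eventually_happens'[OF trivial_limit_at_top_linorder] by blast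
    show ?thesis using T0[OF T(1)]
    proof eventually_elim
      case (elim x)
      then show ?case
      proof eventually_elim
        case (elim N)
        have "dist (A x N) M \<le> dist (A x N) (m T) + dist (m T) M" by (rule dist_triangle)
        with elim T(2) \<open>e > 0\<close> have "dist (A x N) M < 3 * e" unfolding dist_norm by linarith
        then show ?case by (simp add: e_def)
      qed
    qed
  qed
  then have "AE x in lebesgue. \<forall>k. \<forall>\<^sub>F N in sequentially. dist (A x N) M < inverse (real (Suc k))"
    by (subst AE_all_countable) auto
  then show ?thesis
  proof eventually_elim
    case (elim x)
    have "A x \<longlonglongrightarrow> M"
    proof (rule tendstoI)
      fix e :: real assume "e > 0"
      then obtain k where "inverse (real (Suc k)) < e" using reals_Archimedean by blast
      with elim show "\<forall>\<^sub>F N in sequentially. dist (A x N) M < e"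
        by (auto elim!: eventually_mono dest!: spec[of _ k])
    qed
    then show ?case by (simp add: \<open>mean f = M\<close> A_def[abs_def])
  qed
qed

end
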